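(* The class of stationary policies is not adequate for the almost-surely constrained problem: there exist a constrained Markov decision process $\mathcal{M}=(\mathcal{S},\mathcal{A},p,r,d)$, a damage budget $\Delta\in\mathbb{N}$ and an initial state $s\in\mathcal{S}$ such that the set of stationary policies of $\mathcal{M}$ is not adequate for the problem $$\max_{\pi\in\Pi_H}\ \mathbb{E}_\pi\Big[\sum_{t=0}^\infty R_{t+1}\,\Big|\,S_0=s\Big]\quad\text{s.t.}\quad P_\pi\Big(\sum_{t=0}^\infty D_{t+1}\le \Delta\,\Big|\,S_0=s\Big)=1 .$$
   Context: A constrained Markov decision process (CMDP) $\mathcal{M}=(\mathcal{S},\mathcal{A},p,r,d)$ has a finite state set $\mathcal{S}$, a finite action set $\mathcal{A}$, and a transition kernel $p(s',r,d\mid s,a)$ giving the joint conditional law of the next state $S_{t+1}=s'$, the reward $R_{t+1}=r\in\mathbb{R}$ and the binary damage indicator $D_{t+1}=d\in\{0,1\}$ given $S_t=s,A_t=a$. Standing assumptions: rewards have finite conditional expectation given $(s,a)$; there is an absorbing termination state in which the system remains with no further reward; and this state is eventually reached (with probability one) under any policy. The history at time $t$ is $h_t=(s_0,a_0,r_1,d_1,s_1,\dots,s_{t-1},a_{t-1},r_t,d_t,s_t)$. $\Pi_H$ is the set of history-dependent (randomized) policies, which choose $A_t$ according to a distribution $\pi(\cdot\mid h_t)$ on $\mathcal{A}$. A stationary policy is one for which the distribution of $A_t$ depends only on the current state: $\pi(\cdot\mid s_t)$ (randomization allowed). A policy is feasible if it satisfies the constraint of the problem. A set of policies $\Pi$ is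 adequate if for every feasible history-dependent policy $\pi_h$ there is a feasible policy $\pi\in\Pi$ with $\mathbb{E}_\pi[\sum_{t\ge0}R_{t+1}\mid S_0=s]=\mathbb{E}_{\pi_h}[\sum_{t\ge0}R_{t+1}\mid S_0=s]$. *)

theory Defs
  imports "HOL-Probability.Probability"
begin

record ('s, 'a) cmdp =
  states :: "'s set"
  actions :: "'a set"
  transition :: "'s \<Rightarrow> 'a \<Rightarrow> ('s \<times> real \<times> bool) measure"

definition outcome_space :: "('s, 'a) cmdp \<Rightarrow> ('s \<times> real \<times> bool) measure" where
  "outcome_space M = count_space (states M) \<Otimes>\<^sub>M borel \<Otimes>\<^sub>M count_space UNIV"

(* The step at time t is (A_t, R_{t+1}, D_{t+1}, S_{t+1}). A trajectory is the initial state together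
   with the sequence of steps; the history h_t is the initial state with the steps at times i < t. *)
type_synonym ('s, 'a) step = "'a \<times> real \<times> bool \<times> 's"

type_synonym ('s, 'a) history = "'s \<times> (nat \<Rightarrow> ('s, 'a) step)"

type_synonym ('s, 'a) policy = "nat \<Rightarrow> ('s, 'a) history \<Rightarrow> 'a measure"

definition step_space :: "('s, 'a) cmdp \<Rightarrow> ('s, 'a) step measure" where
  "step_space M =
     count_space (actions M) \<Otimes>\<^sub>M borel \<Otimes>\<^sub>M count_space UNIV \<Otimes>\<^sub>M count_space (states M)"

definition history_space :: "('s, 'a) cmdp \<Rightarrow> nat \<Rightarrow> ('s, 'a) history measure" where
  "history_space M t = count_space (states M) \<Otimes>\<^sub>M PiM {0..<t} (\<lambda>_. step_space M)"

fun step_reward :: "('s, 'a) step \<Rightarrow> real" where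
  "step_reward (a, r, d, s') = r"

fun step_damage :: "('s, 'a) step \<Rightarrow> bool" where
  "step_damage (a, r, d, s') = d"

fun step_next :: "('s, 'a) step \<Rightarrow> 's" where
  "step_next (a, r, d, s') = s'"

fun state_at :: "('s, 'a) history \<Rightarrow> nat \<Rightarrow> 's" where
  "state_at (s, \<omega>) 0 = s"
| "state_at (s, \<omega>) (Suc t) = step_next (\<omega> t)"

definition policies :: "('s, 'a) cmdp \<Rightarrow> ('s, 'a) policy set" where
  "policies M = {\<pi>. \<forall>t. \<pi> t \<in> history_space M t \<rightarrow>\<^sub>M prob_algebra (count_space (actions M))}"

definition stationary_policies :: "('s, 'a) cmdp \<Rightarrow> ('s, 'a) policy set" where
  "stationary_policies M =
     {\<pi> \<in> policies M. \<exists>f. \<forall>t. \<forall>h \<in> space (history_space M t). \<pi> t h = f (state_at h t)}"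

definition step_kernel ::
  "('s, 'a) cmdp \<Rightarrow> ('s, 'a) policy \<Rightarrow> 's \<Rightarrow> nat \<Rightarrow> (nat \<Rightarrow> ('s, 'a) step) \<Rightarrow> ('s, 'a) step measure"
  where
  "step_kernel M \<pi> s t \<omega> =
     \<pi> t (s, \<omega>) \<bind>
       (\<lambda>a. distr (transition M (state_at (s, \<omega>) t) a) (step_space M) (\<lambda>(s', r, d). (a, r, d, s')))"

(* The law of the step sequence given S_0 = s, obtained from the step kernels by the
   Ionescu-Tulcea theorem. *)
definition trajectory :: "('s, 'a) cmdp \<Rightarrow> ('s, 'a) policy \<Rightarrow> 's \<Rightarrow> (nat \<Rightarrow> ('s, 'a) step) measure" where
  "trajectory M \<pi> s =
     projective_family.lim UNIV
       (Ionescu_Tulcea.CI (step_kernel M \<pi> s) (\<lambda>_. step_space M)) (\<lambda>_. step_space M)"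

(* Absorption does not rule out damage in the termination state. *)
definition termination_state :: "('s, 'a) cmdp \<Rightarrow> 's \<Rightarrow> bool" where
  "termination_state M z \<longleftrightarrow>
     z \<in> states M \<and>
     (\<forall>a \<in> actions M. AE (s', r, d) in transition M z a. s' = z \<and> r = 0) \<and>
     (\<forall>\<pi> \<in> policies M. \<forall>s \<in> states M.
        \<P>(\<omega> in trajectory M \<pi> s. \<exists>t. state_at (s, \<omega>) t = z) = 1)"

definition cmdp :: "('s, 'a) cmdp \<Rightarrow> bool" where
  "cmdp M \<longleftrightarrow>
     finite (states M) \<and> finite (actions M) \<and> actions M \<noteq> {} \<and>
     (\<forall>s \<in> states M. \<forall>a \<in> actions M.
        transition M s a \<in> space (prob_algebra (outcome_space M)) \<and>
        integrable (transition M s a) (\<lambda>(s', r, d). r)) \<and>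
     (\<exists>z. termination_state M z)"

lemma state_at_measurable:
  assumes "s \<in> states M"
  shows "(\<lambda>\<omega>. state_at (s, \<omega>) t) \<in> PiM {0..<t} (\<lambda>_. step_space M) \<rightarrow>\<^sub>M count_space (states M)"
proof (cases t)
  case 0 then show ?thesis using assms by simp
next
  case (Suc k)
  have n: "step_next = (\<lambda>x. snd (snd (snd x)))" by (auto simp: fun_eq_iff)
  have "(\<lambda>x. snd (snd (snd x))) \<in> step_space M \<rightarrow>\<^sub>M count_space (states M)"
    unfolding step_space_def by measurable
  then show ?thesis using Suc by (auto simp: n)
qed

lemma Ionescu_Tulcea_step_kernel:
  assumes M: "cmdp M" and p: "\<pi> \<in> policies M" and s: "s \<in> states M"
  shows "Ionescu_Tulcea (step_kernel M \<pi> s) (\<lambda>_. step_space M)"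
proof -
  have K: "step_kernel M \<pi> s t \<in> PiM {0..<t} (\<lambda>_. step_space M) \<rightarrow>\<^sub>M prob_algebra (step_space M)" for t
  proof -
    have fin: "countable (states M)" "countable (actions M)"
      using M by (auto simp: cmdp_def countable_finite)
    let ?H = "PiM {0..<t} (\<lambda>_. step_space M)"
    let ?g = "\<lambda>(s', a). distr (transition M s' a) (step_space M) (\<lambda>(s', r, d). (a, r, d, s'))"
    have 1: "(\<lambda>\<omega>. \<pi> t (s, \<omega>)) \<in> ?H \<rightarrow>\<^sub>M prob_algebra (count_space (actions M))"
    proof -
      have "(\<lambda>\<omega>. (s, \<omega>)) \<in> ?H \<rightarrow>\<^sub>M history_space M t"
        unfolding history_space_def using s by auto
      then show ?thesis using p by (auto simp: policies_def intro: measurable_compose)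
    qed
    have g: "?g \<in> count_space (states M \<times> actions M) \<rightarrow>\<^sub>M prob_algebra (step_space M)"
    proof (clarsimp simp: measurable_count_space_eq1 space_prob_algebra)
      fix s' a assume a: "s' \<in> states M" "a \<in> actions M"
      then have k: "transition M s' a \<in> space (prob_algebra (outcome_space M))"
        using M by (auto simp: cmdp_def)
      have "(\<lambda>(s', r, d). (a, r, d, s')) \<in> outcome_space M \<rightarrow>\<^sub>M step_space M"
        unfolding outcome_space_def step_space_def split_beta'
        by (intro measurable_Pair measurable_const)
          (use a in \<open>auto intro: measurable_compose[OF measurable_snd] measurable_fst measurable_snd\<close>)
      then show "prob_space (distr (transition M s' a) (step_space M) (\<lambda>(s', r, d). (a, r, d, s')))"
        using k by (intro prob_space.prob_space_distr)
          (auto simp: space_prob_algebra cong: measurable_cong_sets)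
    qed
    then have g: "?g \<in> count_space (states M) \<Otimes>\<^sub>M count_space (actions M) \<rightarrow>\<^sub>M prob_algebra (step_space M)"
      using fin by (simp add: pair_measure_countable)
    have "(\<lambda>(\<omega>, a). ?g (state_at (s, \<omega>) t, a)) \<in> ?H \<Otimes>\<^sub>M count_space (actions M) \<rightarrow>\<^sub>M prob_algebra (step_space M)"
      using measurable_compose[OF measurable_Pair[OF measurable_compose[OF measurable_fst
          state_at_measurable[OF s, of t]] measurable_snd] g]
      unfolding split_beta' fst_conv snd_conv .
    from measurable_bind_prob_space2[OF 1, of "\<lambda>\<omega> a. ?g (state_at (s, \<omega>) t, a)", OF this]
    show ?thesis unfolding step_kernel_def[abs_def] split_beta' fst_conv snd_conv .
  qed
  show ?thesis
  proof (rule Ionescu_Tulcea.intro)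
    show "step_kernel M \<pi> s t \<in> PiM {0..<t} (\<lambda>_. step_space M) \<rightarrow>\<^sub>M subprob_algebra (step_space M)" for t
      by (rule measurable_prob_algebraD[OF K])
  next
    show "prob_space (step_kernel M \<pi> s t \<omega>)" if "\<omega> \<in> space (PiM {0..<t} (\<lambda>_. step_space M))" for t \<omega>
      using measurable_space[OF K that] unfolding space_prob_algebra by blast
  qed
qed

lemma trajectory_prob_space:
  assumes M: "cmdp M" and p: "\<pi> \<in> policies M" and s: "s \<in> states M"
  shows "prob_space (trajectory M \<pi> s)"
    and "sets (trajectory M \<pi> s) = sets (PiM UNIV (\<lambda>_. step_space M))"
proof -
  interpret Ionescu_Tulcea "step_kernel M \<pi> s" "\<lambda>_. step_space M"
    by (rule Ionescu_Tulcea_step_kernel[OF assms])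
  have "prob_space (distr PF.lim (PiM {} (\<lambda>_. step_space M)) (\<lambda>x. restrict x {}))"
    by (subst distr_lim) (auto intro: PF.prob_space_P)
  then show "prob_space (trajectory M \<pi> s)"
    unfolding trajectory_def
    by (rule prob_space_distrD[rotated])
      (simp add: measurable_cong_sets[OF PF.sets_lim refl] measurable_restrict_subset)
  show "sets (trajectory M \<pi> s) = sets (PiM UNIV (\<lambda>_. step_space M))"
    unfolding trajectory_def by simp
qed

(* In a cmdp, termination makes all but finitely many rewards vanish almost surely, so the series
   converges almost surely. *)
definition expected_return :: "('s, 'a) cmdp \<Rightarrow> ('s, 'a) policy \<Rightarrow> 's \<Rightarrow> real" where
  "expected_return M \<pi> s = (\<integral>\<omega>. (\<Sum>t. step_reward (\<omega> t)) \<partial>trajectory M \<pi> s)"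

definition feasible :: "('s, 'a) cmdp \<Rightarrow> nat \<Rightarrow> 's \<Rightarrow> ('s, 'a) policy \<Rightarrow> bool" where
  "feasible M \<Delta> s \<pi> \<longleftrightarrow>
     \<P>(\<omega> in trajectory M \<pi> s. (\<Sum>t. of_bool (step_damage (\<omega> t)) :: ennreal) \<le> of_nat \<Delta>) = 1"

definition adequate :: "('s, 'a) cmdp \<Rightarrow> nat \<Rightarrow> 's \<Rightarrow> ('s, 'a) policy set \<Rightarrow> bool" where
  "adequate M \<Delta> s P \<longleftrightarrow>
     (\<forall>\<pi>\<^sub>h \<in> policies M. feasible M \<Delta> s \<pi>\<^sub>h \<longrightarrow>
        (\<exists>\<pi> \<in> P. feasible M \<Delta> s \<pi> \<and> expected_return M \<pi> s = expected_return M \<pi>\<^sub>h s))"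

end

theory Submission
  imports Defs
begin

text \<open>
  From the start state 0 every action leads to state 1, with damage decided by a fair coin. In state 1,
  action 1 earns reward 1 at the price of certain damage, action 0 is free of both, and either leads to
  the absorbing state 2. With damage budget 1, the policy that takes action 1 exactly when the coin
  caused no damage is feasible and earns 1/2. A stationary policy cannot see the coin in state 1: if it
  takes action 1 there with probability \<open>c\<close>, it suffers damage twice with probability \<open>c / 2\<close>.
  Feasibility forces \<open>c = 0\<close>, and then its return is 0.
\<close>

section \<open>Components of a step and their measurability\<close>

fun step_action :: "('s, 'a) step \<Rightarrow> 'a" where
  "step_action (a, r, d, s') = a"

lemma step_fun_defs:
  "step_action = fst"
  "step_reward = (\<lambda>x. fst (snd x))"
  "step_damage = (\<lambda>x. fst (snd (snd x)))"
  "step_next = (\<lambda>x. snd (snd (snd x)))"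
  by (auto simp: fun_eq_iff)

lemma measurable_count_space_UNIV:
  assumes "f \<in> N \<rightarrow>\<^sub>M count_space A"
  shows "f \<in> N \<rightarrow>\<^sub>M count_space UNIV"
  using measurable_compose[OF assms, of "\<lambda>x. x" "count_space UNIV"] by simp

text \<open>With target \<open>count_space UNIV\<close> instead of the carrier of the model, tests
  such as \<open>step_action x = 1\<close> are measurable predicates without side conditions on
  states and actions.\<close>

lemma measurable_step [measurable]:
  "step_action \<in> step_space M \<rightarrow>\<^sub>M count_space UNIV"
  "step_reward \<in> borel_measurable (step_space M)"
  "step_damage \<in> step_space M \<rightarrow>\<^sub>M count_space UNIV"
  "step_next \<in> step_space M \<rightarrow>\<^sub>M count_space UNIV"
proof -
  have "step_action \<in> step_space M \<rightarrow>\<^sub>M count_space (actions M)"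
    "step_next \<in> step_space M \<rightarrow>\<^sub>M count_space (states M)"
    unfolding step_fun_defs step_space_def by measurable
  then show "step_action \<in> step_space M \<rightarrow>\<^sub>M count_space UNIV"
    "step_next \<in> step_space M \<rightarrow>\<^sub>M count_space UNIV"
    by (blast intro: measurable_count_space_UNIV)+
  show "step_reward \<in> borel_measurable (step_space M)"
    "step_damage \<in> step_space M \<rightarrow>\<^sub>M count_space UNIV"
    unfolding step_fun_defs step_space_def by measurable
qed

text \<open>The state at a positive time \<open>t\<close> is read off the step at time
  \<open>t - 1\<close>, so the first \<open>n\<close> steps also determine the state at time
  \<open>n\<close> itself; hence a bound that allows equality, here and for the update
  below.\<close>

lemma state_at_restrict [simp]:
  "t \<le> n \<Longrightarrow> state_at (s, restrict \<omega> {0..<n}) t = state_at (s, \<omega>) t"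
  by (cases t) auto

lemma state_at_fun_upd [simp]:
  "t \<le> n \<Longrightarrow> state_at (s, fun_upd \<omega> n x) t = state_at (s, \<omega>) t"
  by (cases t) auto

text \<open>The map along which \<open>step_kernel\<close> pushes a transition forward, given a name
  so that simp rules on components replace case splits on tuples.\<close>

definition outcome_step :: "'a \<Rightarrow> 's \<times> real \<times> bool \<Rightarrow> ('s, 'a) step" where
  "outcome_step a = (\<lambda>(s', r, d). (a, r, d, s'))"

lemma outcome_step_simps [simp]:
  "step_action (outcome_step a x) = a"
  "step_next (outcome_step a x) = fst x"
  "step_reward (outcome_step a x) = fst (snd x)"
  "step_damage (outcome_step a x) = snd (snd x)"
  by (auto simp: outcome_step_def split: prod.splits)

lemma measurable_outcome_step:
  assumes "a \<in> actions M"
  shows "outcome_step a \<in> outcome_space M \<rightarrow>\<^sub>M step_space M"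
  unfolding outcome_step_def split_beta' outcome_space_def step_space_def
  by (intro measurable_Pair measurable_const)
    (use assms in \<open>auto intro: measurable_compose[OF measurable_snd] measurable_fst measurable_snd\<close>)

section \<open>Disintegration of the trajectory law by single steps\<close>

text \<open>
  No termination state is assumed: its existence is itself a claim about the laws of the trajectories,
  which must therefore be available before \<^const>\<open>cmdp\<close> is known to hold.
\<close>

locale controlled_process =
  fixes M :: "('s, 'a) cmdp" and \<pi> :: "('s, 'a) policy" and s :: 's
  assumes finite_states: "finite (states M)"
    and finite_actions: "finite (actions M)"
    and transition: "\<And>x a. x \<in> states M \<Longrightarrow> a \<in> actions M \<Longrightarrow>
      transition M x a \<in> space (prob_algebra (outcome_space M))"
    and policy: "\<pi> \<in> policies M"
    and initial: "s \<in> states M"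
begin

abbreviation "H (t::nat) \<equiv> PiM {0..<t} (\<lambda>_. step_space M)"
abbreviation "T \<equiv> trajectory M \<pi> s"

lemma measurable_state_at:
  "(\<lambda>\<omega>. state_at (s, \<omega>) t) \<in> H t \<rightarrow>\<^sub>M count_space (states M)"
  by (rule state_at_measurable[OF initial])

lemma measurable_state_at_UNIV [measurable]:
  assumes "t \<le> n"
  shows "(\<lambda>\<omega>. state_at (s, \<omega>) t) \<in> H n \<rightarrow>\<^sub>M count_space UNIV"
proof -
  have "(\<lambda>\<omega>. restrict \<omega> {0..<t}) \<in> H n \<rightarrow>\<^sub>M H t"
    using assms by (intro measurable_restrict_subset) auto
  from measurable_count_space_UNIV[OF measurable_compose[OF this measurable_state_at]] show ?thesis
    by simp
qed

lemma policy_kernel [measurable]: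
  "(\<lambda>\<omega>. \<pi> t (s, \<omega>)) \<in> H t \<rightarrow>\<^sub>M prob_algebra (count_space (actions M))"
proof -
  have "(\<lambda>\<omega>. (s, \<omega>)) \<in> H t \<rightarrow>\<^sub>M history_space M t"
    unfolding history_space_def using initial by (intro measurable_Pair1') simp
  then show ?thesis
    using policy unfolding policies_def by (auto intro: measurable_compose)
qed

text \<open>States and actions are finite, so the product of their count spaces is again a count
  space, and measurability reduces to each value being a probability measure.\<close>

lemma outcome_kernel:
  "(\<lambda>(x, a). distr (transition M x a) (step_space M) (outcome_step a))
     \<in> count_space (states M) \<Otimes>\<^sub>M count_space (actions M) \<rightarrow>\<^sub>M prob_algebra (step_space M)"
proof -
  have "distr (transition M x a) (step_space M) (outcome_step a) \<in> space (prob_algebra (step_space M))"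
    if "x \<in> states M" "a \<in> actions M" for x a
    using measurable_space[OF measurable_distr_prob_space[OF measurable_outcome_step[OF that(2)]]
      transition[OF that]] .
  then show ?thesis
    using finite_states finite_actions
    by (auto simp: pair_measure_countable countable_finite measurable_count_space_eq1)
qed

lemma step_kernel_eq:
  "step_kernel M \<pi> s t \<omega> =
     \<pi> t (s, \<omega>) \<bind> (\<lambda>a. distr (transition M (state_at (s, \<omega>) t) a) (step_space M) (outcome_step a))"
  by (simp add: step_kernel_def outcome_step_def)

lemma measurable_step_kernel:
  "step_kernel M \<pi> s t \<in> H t \<rightarrow>\<^sub>M prob_algebra (step_space M)"
proof -
  have "(\<lambda>(\<omega>, a). distr (transition M (state_at (s, \<omega>) t) a) (step_space M) (outcome_step a))
      \<in> H t \<Otimes>\<^sub>M count_space (actions M) \<rightarrow>\<^sub>M prob_algebra (step_space M)"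
    using measurable_compose[OF measurable_Pair[OF measurable_compose[OF measurable_fst
        measurable_state_at] measurable_snd] outcome_kernel]
    by (simp add: split_beta')
  from measurable_bind_prob_space2[OF policy_kernel this] show ?thesis
    unfolding step_kernel_eq[abs_def] .
qed

sublocale Ionescu_Tulcea "step_kernel M \<pi> s" "\<lambda>_. step_space M"
proof (rule Ionescu_Tulcea.intro)
  show "step_kernel M \<pi> s t \<in> H t \<rightarrow>\<^sub>M subprob_algebra (step_space M)" for t
    by (rule measurable_prob_algebraD[OF measurable_step_kernel])
  show "prob_space (step_kernel M \<pi> s t \<omega>)" if "\<omega> \<in> space (H t)" for t \<omega>
    using measurable_space[OF measurable_step_kernel that] by (simp add: space_prob_algebra)
qed

lemma trajectory_eq: "T = PF.lim"
  by (simp add: trajectory_def)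

lemma sets_trajectory [measurable_cong]: "sets T = sets (PiM UNIV (\<lambda>_. step_space M))"
  by (simp add: trajectory_eq)

lemma measurable_restrict_trajectory [measurable]:
  "(\<lambda>\<omega>. restrict \<omega> {0..<t}) \<in> T \<rightarrow>\<^sub>M H t"
  by (simp add: measurable_cong_sets[OF sets_trajectory refl] measurable_restrict_subset)

lemma measurable_state_at_trajectory [measurable]:
  "(\<lambda>\<omega>. state_at (s, \<omega>) t) \<in> T \<rightarrow>\<^sub>M count_space UNIV"
  using measurable_count_space_UNIV[OF measurable_compose[OF measurable_restrict_trajectory measurable_state_at]]
  by simp

lemma distr_trajectory:
  "distr T (H t) (\<lambda>\<omega>. restrict \<omega> {0..<t}) = C 0 t (\<lambda>_. undefined)"
proof -
  \<comment> \<open>The marginal \<open>CI\<close> on a finite index set restricts the kernel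
    composite up to the least bound beyond that set. For \<open>{0..<t}\<close> this bound is
    \<open>t\<close>, so the restriction changes nothing.\<close>
  have "up_to {0..<t} = t"
    by (intro antisym) (auto simp: up_to_iff dest: up_to_less[of "{0..<t}"], use up_to[of "{0..<t}"] in auto)
  then show ?thesis
    using distr_C[of t t "\<lambda>_. undefined" 0]
    by (simp add: trajectory_eq distr_lim CI_def)
qed

sublocale trajectory: prob_space T
proof -
  have "prob_space (distr T (H 0) (\<lambda>\<omega>. restrict \<omega> {0..<0}))"
    unfolding distr_trajectory by (rule prob_space_C) simp
  then show "prob_space T"
    by (rule prob_space_distrD[OF measurable_restrict_trajectory])
qed

lemma nn_integral_step_kernel:
  assumes \<omega>: "\<omega> \<in> space (H t)" and F: "F \<in> borel_measurable (step_space M)"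
  shows "(\<integral>\<^sup>+x. F x \<partial>step_kernel M \<pi> s t \<omega>) =
    (\<integral>\<^sup>+a. \<integral>\<^sup>+x. F (outcome_step a x) \<partial>transition M (state_at (s, \<omega>) t) a \<partial>\<pi> t (s, \<omega>))"
proof -
  have x: "state_at (s, \<omega>) t \<in> states M"
    using measurable_space[OF measurable_state_at \<omega>] by simp
  have sets_pi: "sets (\<pi> t (s, \<omega>)) = sets (count_space (actions M))"
    using measurable_space[OF policy_kernel \<omega>] by (simp add: space_prob_algebra)
  have *: "(\<lambda>a. distr (transition M (state_at (s, \<omega>) t) a) (step_space M) (outcome_step a))
      \<in> \<pi> t (s, \<omega>) \<rightarrow>\<^sub>M subprob_algebra (step_space M)"
    using measurable_compose[OF measurable_Pair1' outcome_kernel] x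
    by (intro measurable_prob_algebraD) (simp add: measurable_cong_sets[OF sets_pi refl])
  show ?thesis
    unfolding step_kernel_eq nn_integral_bind[OF F *]
  proof (rule nn_integral_cong)
    fix a assume "a \<in> space (\<pi> t (s, \<omega>))"
    then have a: "a \<in> actions M"
      using sets_eq_imp_space_eq[OF sets_pi] by simp
    have "sets (transition M (state_at (s, \<omega>) t) a) = sets (outcome_space M)"
      using transition[OF x a] by (simp add: space_prob_algebra)
    then show "(\<integral>\<^sup>+y. F y \<partial>distr (transition M (state_at (s, \<omega>) t) a) (step_space M) (outcome_step a)) =
        (\<integral>\<^sup>+y. F (outcome_step a y) \<partial>transition M (state_at (s, \<omega>) t) a)"
      using measurable_outcome_step[OF a] F
      by (intro nn_integral_distr) (simp_all cong: measurable_cong_sets)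
  qed
qed

text \<open>The composite kernel up to \<open>Suc t\<close> is the one up to \<open>t\<close>
  followed by \<open>eP t\<close>, which appends a step drawn from the step kernel. The last step
  can therefore be integrated out first, as an outcome given an action given the history. All
  probabilities and almost-sure claims below are derived from this formula.\<close>

lemma nn_integral_trajectory:
  assumes f [measurable]: "f \<in> borel_measurable (H (Suc t))"
  shows "(\<integral>\<^sup>+\<omega>. f (restrict \<omega> {0..<Suc t}) \<partial>T) =
    (\<integral>\<^sup>+\<omega>. \<integral>\<^sup>+a. \<integral>\<^sup>+x. f ((restrict \<omega> {0..<t})(t := outcome_step a x))
       \<partial>transition M (state_at (s, \<omega>) t) a \<partial>\<pi> t (s, restrict \<omega> {0..<t}) \<partial>T)"
proof -
  let ?u = "\<lambda>_. undefined"
  have "(\<integral>\<^sup>+\<omega>. f (restrict \<omega> {0..<Suc t}) \<partial>T) = (\<integral>\<^sup>+\<omega>. f \<omega> \<partial>C 0 (Suc t) ?u)"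
    by (simp add: distr_trajectory[symmetric] nn_integral_distr del: C.simps)
  also have "\<dots> = (\<integral>\<^sup>+\<omega>. \<integral>\<^sup>+\<omega>'. f \<omega>' \<partial>eP t \<omega> \<partial>C 0 t ?u)"
    using measurable_eP[of t] sets_C[of ?u 0 t]
    by (simp add: nn_integral_bind[OF f] cong: measurable_cong_sets)
  also have "\<dots> = (\<integral>\<^sup>+\<omega>. \<integral>\<^sup>+\<omega>'. f \<omega>' \<partial>eP t (restrict \<omega> {0..<t}) \<partial>T)"
    unfolding distr_trajectory[symmetric]
    by (intro nn_integral_distr nn_integral_measurable_subprob_algebra2) measurable
  also have "\<dots> = (\<integral>\<^sup>+\<omega>. \<integral>\<^sup>+a. \<integral>\<^sup>+x. f ((restrict \<omega> {0..<t})(t := outcome_step a x))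
       \<partial>transition M (state_at (s, \<omega>) t) a \<partial>\<pi> t (s, restrict \<omega> {0..<t}) \<partial>T)"
  proof (rule nn_integral_cong)
    fix \<omega> assume "\<omega> \<in> space T"
    then have \<omega>: "restrict \<omega> {0..<t} \<in> space (H t)"
      by (rule measurable_space[OF measurable_restrict_trajectory])
    have "(\<lambda>x. f ((restrict \<omega> {0..<t})(t := x))) \<in> borel_measurable (step_space M)"
      using \<omega> by (intro measurable_compose[OF _ f] measurable_fun_upd[where J = "{0..<t}"]) auto
    from nn_integral_step_kernel[OF \<omega> this]
    show "(\<integral>\<^sup>+\<omega>'. f \<omega>' \<partial>eP t (restrict \<omega> {0..<t})) =
      (\<integral>\<^sup>+a. \<integral>\<^sup>+x. f ((restrict \<omega> {0..<t})(t := outcome_step a x))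
       \<partial>transition M (state_at (s, \<omega>) t) a \<partial>\<pi> t (s, restrict \<omega> {0..<t}))"
      by (simp only: nn_integral_eP[OF \<omega> f] state_at_restrict order_refl)
  qed
  finally show ?thesis .
qed

text \<open>Integrate the indicator of failure with \<open>nn_integral_trajectory\<close>: the two
  inner integrals vanish for every history, so failure has probability zero.\<close>

lemma AE_trajectory:
  assumes P [measurable]: "Measurable.pred (H (Suc t)) P"
    and AE: "\<And>\<omega>. \<omega> \<in> space (H t) \<Longrightarrow>
      AE a in \<pi> t (s, \<omega>). AE x in transition M (state_at (s, \<omega>) t) a. P (fun_upd \<omega> t (outcome_step a x))"
  shows "AE \<omega> in T. P (restrict \<omega> {0..<Suc t})"
proof -
  let ?f = "indicator {\<omega>. \<not> P \<omega>} :: _ \<Rightarrow> ennreal"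
  have [measurable]: "?f \<in> borel_measurable (H (Suc t))"
    by (simp add: indicator_def)
  have "(\<integral>\<^sup>+\<omega>. ?f (restrict \<omega> {0..<Suc t}) \<partial>T) = (\<integral>\<^sup>+\<omega>. 0 \<partial>T)"
    unfolding nn_integral_trajectory[OF \<open>?f \<in> _\<close>]
  proof (rule nn_integral_cong)
    fix \<omega> assume "\<omega> \<in> space T"
    then have \<omega>: "restrict \<omega> {0..<t} \<in> space (H t)"
      by (rule measurable_space[OF measurable_restrict_trajectory])
    have "(\<integral>\<^sup>+a. \<integral>\<^sup>+x. ?f ((restrict \<omega> {0..<t})(t := outcome_step a x))
       \<partial>transition M (state_at (s, \<omega>) t) a \<partial>\<pi> t (s, restrict \<omega> {0..<t})) =
       (\<integral>\<^sup>+a. \<integral>\<^sup>+x. 0 \<partial>transition M (state_at (s, \<omega>) t) a \<partial>\<pi> t (s, restrict \<omega> {0..<t}))"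
      using AE[OF \<omega>, unfolded state_at_restrict[OF order_refl]]
      by (intro nn_integral_cong_AE)
        (erule eventually_mono, intro nn_integral_cong_AE, erule eventually_mono, simp)
    then show "(\<integral>\<^sup>+a. \<integral>\<^sup>+x. ?f ((restrict \<omega> {0..<t})(t := outcome_step a x))
       \<partial>transition M (state_at (s, \<omega>) t) a \<partial>\<pi> t (s, restrict \<omega> {0..<t})) = 0"
      by simp
  qed
  then have "(\<integral>\<^sup>+\<omega>. ?f (restrict \<omega> {0..<Suc t}) \<partial>T) = 0"
    by simp
  then show ?thesis
    by (subst (asm) nn_integral_0_iff_AE) (auto simp: indicator_def split: if_splits)
qed

end

section \<open>The coin-toss model\<close>

definition coin_outcome :: "nat \<Rightarrow> nat \<Rightarrow> bool \<Rightarrow> nat \<times> real \<times> bool" where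
  "coin_outcome x a b =
     (if x = 0 then (1, 0, b) else (2, of_bool (x = 1 \<and> a = 1), x = 1 \<and> a = 1))"

lemma coin_outcome_simps [simp]:
  "fst (coin_outcome x a b) = (if x = 0 then 1 else 2)"
  "fst (snd (coin_outcome x a b)) = of_bool (x = 1 \<and> a = 1)"
  "snd (snd (coin_outcome x a b)) = (if x = 0 then b else x = 1 \<and> a = 1)"
  by (simp_all add: coin_outcome_def)

text \<open>Every transition is the image of one fair coin, even where the outcome ignores it, so
  claims about all transitions reduce uniformly to the two values of the coin.\<close>

definition coin_cmdp :: "(nat, nat) cmdp" where
  "coin_cmdp = \<lparr>states = {0, 1, 2}, actions = {0, 1}, transition = (\<lambda>x a.
     distr (measure_pmf (bernoulli_pmf (1 / 2)))
       (count_space {0, 1, 2} \<Otimes>\<^sub>M borel \<Otimes>\<^sub>M count_space UNIV) (coin_outcome x a))\<rparr>"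

lemma coin_cmdp_simps [simp]:
  "states coin_cmdp = {0, 1, 2}"
  "actions coin_cmdp = {0, 1}"
  by (simp_all add: coin_cmdp_def)

lemma coin_transition:
  "transition coin_cmdp x a =
     distr (measure_pmf (bernoulli_pmf (1 / 2))) (outcome_space coin_cmdp) (coin_outcome x a)"
  by (simp add: coin_cmdp_def outcome_space_def)

lemma measurable_coin_outcome [measurable]:
  "coin_outcome x a \<in> measure_pmf p \<rightarrow>\<^sub>M outcome_space coin_cmdp"
  by (auto simp: coin_outcome_def outcome_space_def space_pair_measure measurable_pmf_measure1)

lemma coin_transition_prob: "transition coin_cmdp x a \<in> space (prob_algebra (outcome_space coin_cmdp))"
  unfolding coin_transition space_prob_algebra
  by (auto intro!: measure_pmf.prob_space_distr measurable_coin_outcome)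

lemma emeasure_coin_transition: "emeasure (transition coin_cmdp x a) (space (transition coin_cmdp x a)) = 1"
  using coin_transition_prob[of x a] by (simp add: space_prob_algebra prob_space.emeasure_space_1)

text \<open>\<open>P\<close> may be non-measurable, whereas \<open>AE_distr_iff\<close> asks for a
  measurable predicate. It is therefore applied to the measurable claim that \<open>y\<close> agrees
  in each component with one of the two possible outcomes, and this claim implies
  \<open>P y\<close>.\<close>

lemma AE_coin_transition:
  assumes "\<And>b. P (coin_outcome x a b)"
  shows "AE y in transition coin_cmdp x a. P y"
proof -
  let ?y = "coin_outcome x a"
  let ?Q = "\<lambda>y b. fst y = fst (?y b) \<and> fst (snd y) = fst (snd (?y b)) \<and> snd (snd y) = snd (snd (?y b))"
  have Q: "{y \<in> space (outcome_space coin_cmdp). \<exists>b. ?Q y b} \<in> sets (outcome_space coin_cmdp)"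
    unfolding outcome_space_def by measurable
  have "AE y in transition coin_cmdp x a. \<exists>b. ?Q y b"
    unfolding coin_transition AE_distr_iff[OF measurable_coin_outcome Q] by (intro AE_I2) blast
  then show ?thesis
  proof eventually_elim
    case (elim y)
    then obtain b where "?Q y b" ..
    then have "y = coin_outcome x a b"
      by (simp add: prod_eq_iff del: coin_outcome_simps)
    then show "P y" using assms by simp
  qed
qed

lemma integrable_coin_reward: "integrable (transition coin_cmdp x a) (\<lambda>(s', r, d). r)"
proof -
  have "(\<lambda>(s', r, d). r) \<in> borel_measurable (outcome_space coin_cmdp)"
    unfolding outcome_space_def by measurable
  then show ?thesis
    unfolding coin_transition
    by (subst integrable_distr_eq[OF measurable_coin_outcome]) (auto intro!: integrable_measure_pmf_finite)
qed

section \<open>One-step dynamics and termination\<close>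

text \<open>The initial state is kept arbitrary because termination is required from every
  state.\<close>

locale coin_process =
  fixes \<pi> :: "(nat, nat) policy" and s :: nat
  assumes coin_policy: "\<pi> \<in> policies coin_cmdp"
    and coin_initial: "s \<in> states coin_cmdp"
begin

sublocale controlled_process coin_cmdp \<pi> s
  using coin_policy coin_initial coin_transition_prob by unfold_locales auto

text \<open>Each conjunct holds for both values of the coin, whatever the history and the action;
  damage in state 0 is left open because it is the coin itself. Countably many times
  \<open>t\<close> share one null set.\<close>

lemma AE_coin_step:
  "AE \<omega> in T. \<forall>t. step_next (\<omega> t) = (if state_at (s, \<omega>) t = 0 then 1 else 2) \<and>
     step_reward (\<omega> t) = (if state_at (s, \<omega>) t = 1 \<and> step_action (\<omega> t) = 1 then 1 else 0) \<and>
     (state_at (s, \<omega>) t \<noteq> 0 \<longrightarrow> step_damage (\<omega> t) = (state_at (s, \<omega>) t = 1 \<and> step_action (\<omega> t) = 1))"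
proof -
  define Q where "Q t \<omega> \<longleftrightarrow> step_next (\<omega> t) = (if state_at (s, \<omega>) t = 0 then 1 else 2) \<and>
     step_reward (\<omega> t) = (if state_at (s, \<omega>) t = 1 \<and> step_action (\<omega> t) = 1 then 1 else 0) \<and>
     (state_at (s, \<omega>) t \<noteq> 0 \<longrightarrow> step_damage (\<omega> t) = (state_at (s, \<omega>) t = 1 \<and> step_action (\<omega> t) = 1))"
    for t and \<omega> :: "nat \<Rightarrow> (nat, nat) step"
  \<comment> \<open>\<open>Q t\<close> looks only at the state and the step at time
    \<open>t\<close>, so restricting to the first \<open>Suc t\<close> steps does not affect
    it.\<close>
  have "AE \<omega> in T. Q t (restrict \<omega> {0..<Suc t})" for t
  proof (rule AE_trajectory)
    have reward: "Measurable.pred (H (Suc t)) (\<lambda>\<omega>. step_reward (\<omega> t) =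
        (if state_at (s, \<omega>) t = 1 \<and> step_action (\<omega> t) = 1 then 1 else 0))"
      unfolding pred_def by (rule borel_measurable_eq) measurable
    show "Measurable.pred (H (Suc t)) (Q t)"
      unfolding Q_def[abs_def] by (intro pred_intros_logic reward) measurable
  next
    fix \<omega> assume "\<omega> \<in> space (H t)"
    show "AE a in \<pi> t (s, \<omega>). AE x in transition coin_cmdp (state_at (s, \<omega>) t) a.
      Q t (fun_upd \<omega> t (outcome_step a x))"
      by (intro AE_I2 AE_coin_transition) (simp add: Q_def)
  qed
  then have "AE \<omega> in T. Q t \<omega>" for t
    by (simp add: Q_def)
  then show ?thesis
    unfolding Q_def by (rule AE_all_countable[THEN iffD2, OF allI])
qed

lemma AE_terminates: "AE \<omega> in T. \<exists>t. state_at (s, \<omega>) t = 2"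
  using AE_coin_step
proof eventually_elim
  case (elim \<omega>)
  \<comment> \<open>From state 0 the path is 0, 1, 2; from 1 or 2 it is in state 2 at time 1 and
    stays there.\<close>
  have "state_at (s, \<omega>) 2 = 2"
    using initial elim[rule_format, of 0] elim[rule_format, of 1] by (auto simp: numeral_2_eq_2)
  then show ?case ..
qed

end

lemma termination_state_coin_cmdp: "termination_state coin_cmdp 2"
  unfolding termination_state_def
proof (intro conjI ballI)
  fix a assume "a \<in> actions coin_cmdp"
  show "AE (s', r, d) in transition coin_cmdp 2 a. s' = 2 \<and> r = 0"
    by (rule AE_coin_transition) (simp add: coin_outcome_def)
next
  fix \<pi> s assume "\<pi> \<in> policies coin_cmdp" "s \<in> states coin_cmdp"
  then interpret coin_process \<pi> s by unfold_locales
  have "{\<omega> \<in> space T. \<exists>t. state_at (s, \<omega>) t = 2} \<in> sets T"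
    by measurable
  then show "\<P>(\<omega> in T. \<exists>t. state_at (s, \<omega>) t = 2) = 1"
    using AE_terminates by (simp add: trajectory.prob_Collect_eq_1)
qed simp

lemma cmdp_coin_cmdp: "cmdp coin_cmdp"
  unfolding cmdp_def
  by (intro conjI ballI exI[of _ 2] coin_transition_prob integrable_coin_reward termination_state_coin_cmdp)
    simp_all

section \<open>Runs from the start state\<close>

locale coin_process_from_start = coin_process \<pi> 0 for \<pi>
begin

text \<open>State 2 is reached at time 2 and is harmless, so damage can occur only at times 0 and 1
  and reward only at time 1. Both series become finite sums, and feasibility and return become
  questions about the first damage and the second action.\<close>

lemma AE_coin_run:
  "AE \<omega> in T. state_at (0, \<omega>) 1 = 1 \<and>
     (\<Sum>t. step_reward (\<omega> t)) = of_bool (step_action (\<omega> 1) = 1) \<and>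
     (\<Sum>t. of_bool (step_damage (\<omega> t)) :: ennreal) =
       of_bool (step_damage (\<omega> 0)) + of_bool (step_action (\<omega> 1) = 1)"
  using AE_coin_step
proof eventually_elim
  case (elim \<omega>)
  have state1: "state_at (0, \<omega>) 1 = 1"
    using elim[rule_format, of 0] by simp
  have state2: "state_at (0, \<omega>) t = 2" if "2 \<le> t" for t
    using that
  proof (induction t rule: dec_induct)
    case base
    show ?case using elim[rule_format, of 1] state1 by (simp add: numeral_2_eq_2)
  next
    case (step t)
    then show ?case using elim[rule_format, of t] by simp
  qed
  have reward: "step_reward (\<omega> t) = of_bool (t = 1 \<and> step_action (\<omega> 1) = 1)"
    and damage: "t \<noteq> 0 \<Longrightarrow> step_damage (\<omega> t) \<longleftrightarrow> t = 1 \<and> step_action (\<omega> 1) = 1" for t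
  proof -
    consider "t = 0" | "t = 1" | "2 \<le> t" by linarith
    then have "step_reward (\<omega> t) = of_bool (t = 1 \<and> step_action (\<omega> 1) = 1) \<and>
        (t \<noteq> 0 \<longrightarrow> step_damage (\<omega> t) = (t = 1 \<and> step_action (\<omega> 1) = 1))"
    proof cases
      case 3
      with elim[rule_format, of t] state2[OF 3] show ?thesis by simp
    qed (use elim[rule_format, of t] state1 in simp_all)
    then show "step_reward (\<omega> t) = of_bool (t = 1 \<and> step_action (\<omega> 1) = 1)"
      and "t \<noteq> 0 \<Longrightarrow> step_damage (\<omega> t) \<longleftrightarrow> t = 1 \<and> step_action (\<omega> 1) = 1"
      by simp_all
  qed
  have "(\<Sum>t. step_reward (\<omega> t)) = (\<Sum>t\<in>{1}. step_reward (\<omega> t))"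
    by (rule suminf_finite) (auto simp: reward)
  moreover have "(\<Sum>t. of_bool (step_damage (\<omega> t)) :: ennreal) = (\<Sum>t\<in>{0, 1}. of_bool (step_damage (\<omega> t)))"
    by (rule suminf_finite) (auto simp: damage)
  ultimately show ?case
    using state1 by (simp add: reward damage)
qed

text \<open>A sum of two 0/1 terms exceeds the budget 1 only if both equal 1.\<close>

lemma feasible_iff:
  "feasible coin_cmdp 1 0 \<pi> \<longleftrightarrow> (AE \<omega> in T. \<not> (step_damage (\<omega> 0) \<and> step_action (\<omega> 1) = 1))"
proof -
  have "{\<omega> \<in> space T. (\<Sum>t. of_bool (step_damage (\<omega> t)) :: ennreal) \<le> of_nat 1} \<in> sets T"
    by measurable
  then have "feasible coin_cmdp 1 0 \<pi> \<longleftrightarrow>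
      (AE \<omega> in T. (\<Sum>t. of_bool (step_damage (\<omega> t)) :: ennreal) \<le> of_nat 1)"
    unfolding feasible_def by (rule trajectory.prob_Collect_eq_1)
  also have "\<dots> \<longleftrightarrow> (AE \<omega> in T. \<not> (step_damage (\<omega> 0) \<and> step_action (\<omega> 1) = 1))"
    by (rule eventually_cong[OF AE_coin_run]) auto
  finally show ?thesis .
qed

lemma expected_return_eq:
  "expected_return coin_cmdp \<pi> 0 = \<P>(\<omega> in T. step_action (\<omega> 1) = 1)"
proof -
  have "expected_return coin_cmdp \<pi> 0 = (\<integral>\<omega>. indicator {\<omega> \<in> space T. step_action (\<omega> 1) = 1} \<omega> \<partial>T)"
    unfolding expected_return_def
  proof (rule integral_cong_AE)
    show "AE \<omega> in T. (\<Sum>t. step_reward (\<omega> t)) = indicator {\<omega> \<in> space T. step_action (\<omega> 1) = 1} \<omega>"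
      using AE_coin_run AE_space by eventually_elim simp
  qed measurable
  then show ?thesis by simp
qed

text \<open>In state 0 the integral over the outcome has the same value for each action, so the
  choice made by the policy at time 0 does not influence the coin.\<close>

lemma emeasure_first_damage: "emeasure T {\<omega> \<in> space T. step_damage (\<omega> 0)} = ennreal (1 / 2)"
proof -
  let ?f = "\<lambda>\<omega>. of_bool (step_damage (\<omega> 0)) :: ennreal"
  have [measurable]: "?f \<in> borel_measurable (H (Suc 0))"
    by measurable
  have inner: "(\<integral>\<^sup>+x. of_bool (snd (snd x)) \<partial>transition coin_cmdp 0 a) = ennreal (1 / 2)" for a
  proof -
    have "(\<lambda>x. of_bool (snd (snd x)) :: ennreal) \<in> borel_measurable (outcome_space coin_cmdp)"
      unfolding outcome_space_def by measurable
    then have "(\<integral>\<^sup>+x. of_bool (snd (snd x)) \<partial>transition coin_cmdp 0 a) =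
        (\<integral>\<^sup>+b. of_bool (snd (snd (coin_outcome 0 a b))) \<partial>measure_pmf (bernoulli_pmf (1 / 2)))"
      unfolding coin_transition by (intro nn_integral_distr measurable_coin_outcome) simp
    also have "\<dots> = ennreal (1 / 2)"
      by (simp add: coin_outcome_def)
    finally show ?thesis .
  qed
  \<comment> \<open>The only history of length 0 is the everywhere undefined sequence, which is also
    what restriction to the empty index set yields.\<close>
  interpret first: prob_space "\<pi> 0 (0, \<lambda>_. undefined)"
    using measurable_space[OF policy_kernel, of "\<lambda>_. undefined" 0] by (simp add: space_prob_algebra)
  have "emeasure T {\<omega> \<in> space T. step_damage (\<omega> 0)} =
      (\<integral>\<^sup>+\<omega>. indicator {\<omega> \<in> space T. step_damage (\<omega> 0)} \<omega> \<partial>T)"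
    by simp
  also have "\<dots> = (\<integral>\<^sup>+\<omega>. ?f (restrict \<omega> {0..<Suc 0}) \<partial>T)"
    by (intro nn_integral_cong) (simp add: indicator_def)
  also have "\<dots> = ennreal (1 / 2)"
    unfolding nn_integral_trajectory[OF \<open>?f \<in> _\<close>]
    using first.emeasure_space_1 trajectory.emeasure_space_1
    by (simp add: inner restrict_def)
  finally show ?thesis .
qed

text \<open>The state at time 1 is almost surely 1, so a stationary policy draws the second action
  from one fixed law, independently of the first step.\<close>

lemma AE_stationary_safe:
  assumes stationary: "\<pi> \<in> stationary_policies coin_cmdp"
    and feasible: "feasible coin_cmdp 1 0 \<pi>"
  shows "AE \<omega> in T. step_action (\<omega> 1) \<noteq> 1"
proof -
  obtain g where g: "\<And>t h. h \<in> space (history_space coin_cmdp t) \<Longrightarrow> \<pi> t h = g (state_at h t)"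
    using stationary unfolding stationary_policies_def by blast
  define c where "c = (\<integral>\<^sup>+a. of_bool (a = 1) \<partial>g 1)"
  \<comment> \<open>Independence is stated for a general event \<open>Q\<close> because it is used
    twice: \<open>step_damage\<close> gives \<open>c / 2 = 0\<close> by feasibility, and the sure
    event identifies \<open>c\<close> as the probability of action 1 at time 1.\<close>
  have factor: "emeasure T {\<omega> \<in> space T. Q (\<omega> 0) \<and> step_action (\<omega> 1) = 1} =
      emeasure T {\<omega> \<in> space T. Q (\<omega> 0)} * c"
    if Q [measurable]: "Measurable.pred (step_space coin_cmdp) Q" for Q
  proof -
    let ?f = "\<lambda>\<omega>. of_bool (Q (\<omega> 0)) * of_bool (step_action (\<omega> 1) = 1) :: ennreal"
    have [measurable]: "?f \<in> borel_measurable (H (Suc 1))"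
      by measurable
    have "emeasure T {\<omega> \<in> space T. Q (\<omega> 0) \<and> step_action (\<omega> 1) = 1} =
        (\<integral>\<^sup>+\<omega>. indicator {\<omega> \<in> space T. Q (\<omega> 0) \<and> step_action (\<omega> 1) = 1} \<omega> \<partial>T)"
      by simp
    also have "\<dots> = (\<integral>\<^sup>+\<omega>. ?f (restrict \<omega> {0..<Suc 1}) \<partial>T)"
      by (intro nn_integral_cong) (simp add: indicator_def)
    also have "\<dots> = (\<integral>\<^sup>+\<omega>. indicator {\<omega> \<in> space T. Q (\<omega> 0)} \<omega> * c \<partial>T)"
      unfolding nn_integral_trajectory[OF \<open>?f \<in> _\<close>]
    \<comment> \<open>The integrands agree only almost everywhere, since the law \<open>g 1\<close>
      applies only on trajectories that are in state 1 at time 1.\<close>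
    proof (rule nn_integral_cong_AE)
      show "AE \<omega> in T. (\<integral>\<^sup>+a. \<integral>\<^sup>+x. ?f ((restrict \<omega> {0..<1})(1 := outcome_step a x))
          \<partial>transition coin_cmdp (state_at (0, \<omega>) 1) a \<partial>\<pi> 1 (0, restrict \<omega> {0..<1})) =
          indicator {\<omega> \<in> space T. Q (\<omega> 0)} \<omega> * c"
        using AE_coin_run AE_space
      proof eventually_elim
        case (elim \<omega>)
        then have "(0, restrict \<omega> {0..<1}) \<in> space (history_space coin_cmdp 1)"
          using measurable_space[OF measurable_restrict_trajectory, of \<omega> 1] initial
          by (simp add: history_space_def space_pair_measure)
        from g[OF this] elim have "\<pi> 1 (0, restrict \<omega> {0..<1}) = g 1"
          by simp
        then show ?case
          using elim by (simp add: c_def emeasure_coin_transition indicator_def)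
      qed
    qed
    also have "\<dots> = emeasure T {\<omega> \<in> space T. Q (\<omega> 0)} * c"
      by (subst nn_integral_multc) auto
    finally show ?thesis .
  qed
  have "emeasure T {\<omega> \<in> space T. step_damage (\<omega> 0) \<and> step_action (\<omega> 1) = 1} = 0"
    using feasible unfolding feasible_iff by (subst (asm) AE_iff_measurable[OF _ refl]) auto
  then have "c = 0"
    using factor[of step_damage] by (auto simp: emeasure_first_damage)
  then have "emeasure T {\<omega> \<in> space T. step_action (\<omega> 1) = 1} = 0"
    using factor[of "\<lambda>_. True"] by simp
  then show ?thesis
    by (subst AE_iff_measurable[OF _ refl]) auto
qed

end

section \<open>The history-dependent policy and the contradiction\<close>

text \<open>The test is on time 1 instead of state 1: from the start state the process is almost
  surely in state 1 at time 1 and at no other time, and the history then consists of the initial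
  state and the step showing the coin.\<close>

definition gamble_if_undamaged :: "(nat, nat) policy" where
  "gamble_if_undamaged t h = return (count_space {0, 1}) (if t = 1 \<and> \<not> step_damage (snd h 0) then 1 else 0)"

lemma gamble_if_undamaged_policy: "gamble_if_undamaged \<in> policies coin_cmdp"
proof -
  have "(\<lambda>h. if t = 1 \<and> \<not> step_damage (snd h 0) then 1 else 0)
      \<in> history_space coin_cmdp t \<rightarrow>\<^sub>M count_space {0, 1 :: nat}" for t
  \<comment> \<open>The coin is read only at time 1, where coordinate 0 belongs to the index set
    \<open>{0..<1}\<close>; at other times the choice is constant.\<close>
  proof (cases "t = 1")
    case True
    have [measurable]: "Measurable.pred (history_space coin_cmdp 1) (\<lambda>h. step_damage (snd h 0))"
      unfolding history_space_def by measurable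
    have "(\<lambda>h. if \<not> step_damage (snd h 0) then 1 else 0 :: nat)
        \<in> history_space coin_cmdp 1 \<rightarrow>\<^sub>M count_space {0, 1}"
      by measurable
    then show ?thesis
      using True by simp
  qed simp
  from measurable_compose[OF this measurable_return_prob_space]
  have "gamble_if_undamaged t \<in> history_space coin_cmdp t \<rightarrow>\<^sub>M prob_algebra (count_space (actions coin_cmdp))" for t
    unfolding gamble_if_undamaged_def[abs_def] coin_cmdp_simps .
  then show ?thesis
    unfolding policies_def by blast
qed

interpretation gamble: coin_process_from_start gamble_if_undamaged
  using gamble_if_undamaged_policy by unfold_locales auto

lemma AE_gamble: "AE \<omega> in gamble.T. step_action (\<omega> 1) = 1 \<longleftrightarrow> \<not> step_damage (\<omega> 0)"
proof -
  have "AE \<omega> in gamble.T. (\<lambda>\<omega>. step_action (\<omega> 1) = 1 \<longleftrightarrow> \<not> step_damage (\<omega> 0)) (restrict \<omega> {0..<Suc 1})"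
  proof (rule gamble.AE_trajectory)
    show "Measurable.pred (gamble.H (Suc 1)) (\<lambda>\<omega>. step_action (\<omega> 1) = 1 \<longleftrightarrow> \<not> step_damage (\<omega> 0))"
      by measurable
  next
    fix \<omega> :: "nat \<Rightarrow> (nat, nat) step"
    show "AE a in gamble_if_undamaged 1 (0, \<omega>). AE x in transition coin_cmdp (state_at (0, \<omega>) 1) a.
        step_action (fun_upd \<omega> 1 (outcome_step a x) 1) = 1 \<longleftrightarrow> \<not> step_damage (fun_upd \<omega> 1 (outcome_step a x) 0)"
      unfolding gamble_if_undamaged_def by (subst AE_return) (auto intro!: AE_I2)
  qed
  then show ?thesis by simp
qed

theorem proposition2:
  shows "\<exists>(M :: (nat, nat) cmdp) (\<Delta> :: nat) s.
           cmdp M \<and> s \<in> states M \<and> \<not> adequate M \<Delta> s (stationary_policies M)"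
proof (intro exI conjI notI)
  show "cmdp coin_cmdp" by (rule cmdp_coin_cmdp)
  show "0 \<in> states coin_cmdp" by simp
  assume adequate: "adequate coin_cmdp 1 0 (stationary_policies coin_cmdp)"
  have "feasible coin_cmdp 1 0 gamble_if_undamaged"
    unfolding gamble.feasible_iff using AE_gamble by eventually_elim auto
  then obtain \<pi> where \<pi>: "\<pi> \<in> stationary_policies coin_cmdp" "feasible coin_cmdp 1 0 \<pi>"
    and eq: "expected_return coin_cmdp \<pi> 0 = expected_return coin_cmdp gamble_if_undamaged 0"
    using adequate gamble_if_undamaged_policy unfolding adequate_def by blast
  interpret coin_process_from_start \<pi>
    using \<pi>(1) by unfold_locales (auto simp: stationary_policies_def)
  have "expected_return coin_cmdp \<pi> 0 = 0"
    unfolding expected_return_eq using AE_stationary_safe[OF \<pi>]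
    by (subst trajectory.prob_eq_0) auto
  \<comment> \<open>Equal returns would mean that the gambling policy almost surely avoids action 1
    at time 1. As it takes that action exactly when the coin causes no damage, damage at time 0
    would be almost sure, against its probability 1/2.\<close>
  then have "AE \<omega> in gamble.T. step_action (\<omega> 1) \<noteq> 1"
    unfolding eq gamble.expected_return_eq by (subst (asm) gamble.trajectory.prob_eq_0) auto
  with AE_gamble have "AE \<omega> in gamble.T. step_damage (\<omega> 0)"
    by eventually_elim auto
  then have "emeasure gamble.T {\<omega> \<in> space gamble.T. step_damage (\<omega> 0)} = 1"
    by (intro gamble.trajectory.emeasure_eq_1_AE) auto
  then have "ennreal (1 / 2) = 1"
    unfolding gamble.emeasure_first_damage .
  then show False
    by (subst (asm) ennreal_eq_1) simp
qed

end
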